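(* For each $n \ge 1$ let $\sigma^n = (\sigma^n_t)_{t}$ be a permutation process of $\mathfrak{S}_n$ of length $t_n$, with $t_n \to \infty$ as $n \to \infty$. Suppose that $\{\sigma^n\}$ converges to a limit $X$, where $X = (X(t), 0 \le t \le 1)$ is a stochastic process with continuous sample paths. Then $X$ is a permuton process. Conversely, given any permuton process $X$, there is a sequence of permutation processes $\{\sigma^n\}$, with $\sigma^n$ a permutation process of $\mathfrak{S}_n$, that converges to $X$.
   Context: $\mathfrak{S}_n$ is the symmetric group on $[n]=\{1,\dots,n\}$. A permutation process of $\mathfrak{S}_n$ of length $t_n$ ($t_n$ a positive integer) is a sequence $\sigma^n = (\sigma^n_t;\ t \in \{0,1,\dots,t_n\})$ of elements of $\mathfrak{S}_n$, where $\sigma^n_0$ is always the identity permutation. For $i\in[n]$, the rescaled trajectory of particle $i$ is the function $T^n_i:[0,1]\to[-1,1]$ with $T^n_i(t/t_n) = \frac{2\sigma^n_t(i)}{n} - 1$ for $t\in\{0,1,\dots,t_n\}$, linearly interpolated between these discrete times. The trajectory process of $\sigma^n$ is the Borel probability measure $X^n = \frac1n \sum_{i=1}^n \delta_{T^n_i}$ on $\mathbf{C}$, the space of continuous functions from $[0,1]$ to $[-1,1]$ with the topology of uniform convergence (equivalently, $X^n$ is the trajectory of a uniformly random particle). The sequence $\{\sigma^n\}$ converges to a stochastic process $X = (X(t), 0\le t\le 1)$ with continuous sample paths if for every uniformly continuous and bounded $F:\mathbf{C}\to\mathbb{R}$, $\frac1n\sum_{i=1}^n F(T^n_i) \to \mathbb{E}[F(X)]$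 as $n\to\infty$ (weak convergence of $X^n$ to the law of $X$ on $\mathbf{C}$). A permuton process is a $[-1,1]$-valued stochastic process $X=(X(t),0\le t\le 1)$ with continuous sample paths such that $X(t)$ has the uniform distribution on $[-1,1]$ for every $t \in [0,1]$. *)

theory Defs
  imports "HOL-Probability.Probability" "HOL-Combinatorics.Permutations"
begin

text \<open>
  The space \<open>\<^bold>C\<close> of continuous functions from \<open>[0,1]\<close> to \<open>[-1,1]\<close> with the uniform metric.
  Its points are extensional functions, i.e. they are \<open>undefined\<close> outside \<open>[0,1]\<close>, so a path
  has to be restricted to \<open>{0..1}\<close> before a functional is applied to it.
\<close>

definition path_space :: "(real \<Rightarrow> real) metric" where
  "path_space = cfunspace (top_of_set {0..1}) (submetric euclidean_metric {-1..1})"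

lemma mspace_path_space:
  "mspace path_space =
     {f. continuous_on {0..1} f \<and> f ` {0..1} \<subseteq> {-1..1} \<and> f \<in> extensional {0..1}}"
proof -
  interpret Metric_space "{-1..1::real}" dist
    by (rule Met_TC.subspace) auto
  have bdd: "mbounded A" if "A \<subseteq> {-1..1}" for A
  proof -
    have "A \<subseteq> mcball 0 1"
      using that by (auto simp: dist_real_def subset_iff)
    then show ?thesis
      by (auto simp: mbounded_def)
  qed
  show ?thesis
    unfolding path_space_def
    by (auto simp: mtopology_of_submetric continuous_map_in_subtopology image_subset_iff Pi_iff
        intro!: bdd)
qed

definition permutation_process :: "nat \<Rightarrow> nat \<Rightarrow> (nat \<Rightarrow> nat \<Rightarrow> nat) \<Rightarrow> bool" where
  "permutation_process n m \<sigma> \<longleftrightarrow>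
     m > 0 \<and> (\<forall>t\<le>m. \<sigma> t permutes {1..n}) \<and> \<sigma> 0 = id"

text \<open>
  For \<open>s = 1\<close> the definition below mentions \<open>\<sigma> (m + 1)\<close>, but with weight \<open>0\<close>.
\<close>

definition trajectory :: "nat \<Rightarrow> nat \<Rightarrow> (nat \<Rightarrow> nat \<Rightarrow> nat) \<Rightarrow> nat \<Rightarrow> real \<Rightarrow> real" where
  "trajectory n m \<sigma> i =
     (\<lambda>s\<in>{0..1}.
        let k = nat \<lfloor>s * real m\<rfloor>;
            p = (\<lambda>t. 2 * real (\<sigma> t i) / real n - 1)
        in (1 - frac (s * real m)) * p k + frac (s * real m) * p (k + 1))"

lemma trajectory_grid:
  assumes "m > 0" "t \<le> m"
  shows "trajectory n m \<sigma> i (real t / real m) = 2 * real (\<sigma> t i) / real n - 1"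
  using assms by (simp add: trajectory_def frac_def)

definition sample_path :: "(real \<Rightarrow> 'a \<Rightarrow> real) \<Rightarrow> 'a \<Rightarrow> real \<Rightarrow> real" where
  "sample_path X \<omega> = (\<lambda>t\<in>{0..1}. X t \<omega>)"

definition continuous_process :: "'a measure \<Rightarrow> (real \<Rightarrow> 'a \<Rightarrow> real) \<Rightarrow> bool" where
  "continuous_process M X \<longleftrightarrow>
     prob_space M \<and>
     (\<forall>t\<in>{0..1}. X t \<in> borel_measurable M) \<and>
     (\<forall>\<omega>\<in>space M. sample_path X \<omega> \<in> mspace path_space)"

definition permuton_process :: "'a measure \<Rightarrow> (real \<Rightarrow> 'a \<Rightarrow> real) \<Rightarrow> bool" where
  "permuton_process M X \<longleftrightarrow>
     continuous_process M X \<and>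
     (\<forall>t\<in>{0..1}. distr M borel (X t) = uniform_measure lborel {-1..1})"

text \<open>
  The left-hand average is the integral of \<open>F\<close> with respect to the empirical measure of the
  \<open>n\<close> rescaled trajectories. The value at \<open>n = 0\<close> is irrelevant for the limit.
\<close>

definition processes_converge_to ::
  "(nat \<Rightarrow> nat) \<Rightarrow> (nat \<Rightarrow> nat \<Rightarrow> nat \<Rightarrow> nat) \<Rightarrow> 'a measure \<Rightarrow> (real \<Rightarrow> 'a \<Rightarrow> real) \<Rightarrow> bool" where
  "processes_converge_to len \<sigma> M X \<longleftrightarrow>
     (\<forall>F. uniformly_continuous_map path_space euclidean_metric F \<and>
          bounded (F ` mspace path_space) \<longrightarrow>
        (\<lambda>n. (1 / real n) * (\<Sum>i=1..n. F (trajectory n (len n) (\<sigma> n) i)))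
          \<longlonglongrightarrow> (\<integral>\<omega>. F (sample_path X \<omega>) \<partial>M))"

end

theory Submission
  imports Defs
begin

text \<open>
  If \<open>\<sigma>\<^sup>n\<close> converges to \<open>X\<close>, then at a grid time the particles occupy each of the \<open>n\<close> sites once, so
  averages of a Lipschitz function \<open>g\<close> are Riemann sums of \<open>g\<close>. Replacing \<open>t\<close> by a nearby grid time
  costs at most the mean oscillation of the trajectories around \<open>t\<close>, which is a uniformly continuous
  functional and so converges to the mean oscillation of \<open>X\<close>; the latter vanishes as the window
  shrinks. Taking sines and cosines for \<open>g\<close> identifies the characteristic function of \<open>X t\<close>.

  Conversely, no randomness is needed. Quantise the paths of \<open>X\<close> on a grid of mesh \<open>1/m\<close> in time and
  space; there are finitely many quantised paths (codes). Distribute \<open>n\<close> particles over the codes in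
  proportion to their probabilities, up to an error of at most one particle per code, and let
  \<open>\<sigma>\<^sub>k\<close> rank the particles by their cell at time \<open>k/m\<close>. Since \<open>X\<close> has uniform marginals, the rank of
  a particle divided by \<open>n\<close> is close to the cell it should occupy. Finally let \<open>m\<close> grow slowly with \<open>n\<close>.
\<close>

section \<open>Paths and their functionals\<close>

lemma mdist_path_space_le:
  assumes "f \<in> mspace path_space" "g \<in> mspace path_space"
  shows "mdist path_space f g \<le> a \<longleftrightarrow> (\<forall>s\<in>{0..1}. \<bar>f s - g s\<bar> \<le> a)"
  using cfunspace_mdist_le[OF assms[unfolded path_space_def]]
  by (simp add: path_space_def dist_real_def)

lemma mdist_path_space_ge:
  assumes "f \<in> mspace path_space" "g \<in> mspace path_space" "s \<in> {0..1}"
  shows "\<bar>f s - g s\<bar> \<le> mdist path_space f g"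
  using mdist_path_space_le[OF assms(1,2), of "mdist path_space f g"] assms(3) by auto

lemma path_space_range:
  assumes "f \<in> mspace path_space" "s \<in> {0..1}"
  shows "f s \<in> {-1..1}"
  using assms by (auto simp: mspace_path_space simp del: atLeastAtMost_iff)

text \<open>Puts uniform continuity in the form in which it is applied: a non-strict pointwise
  estimate suffices, without mention of \<open>mdist\<close>.\<close>

lemma uniformly_continuous_path_functional:
  assumes "uniformly_continuous_map path_space euclidean_metric F" and "\<epsilon> > 0"
  obtains \<delta> where "\<delta> > 0"
    and "\<And>f g. f \<in> mspace path_space \<Longrightarrow> g \<in> mspace path_space \<Longrightarrow>
           (\<And>s. s \<in> {0..1} \<Longrightarrow> \<bar>f s - g s\<bar> \<le> \<delta>) \<Longrightarrow> \<bar>F f - F g\<bar> < (\<epsilon>::real)"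
proof -
  obtain d where d: "d > 0" "\<And>f g. f \<in> mspace path_space \<Longrightarrow> g \<in> mspace path_space \<Longrightarrow>
      mdist path_space f g < d \<Longrightarrow> \<bar>F f - F g\<bar> < \<epsilon>"
    using assms unfolding uniformly_continuous_map_def by (auto simp: dist_real_def)
  show thesis
  \<comment> \<open>Halving turns the non-strict pointwise bound into a distance strictly below
    \<open>d\<close>.\<close>
  proof (rule that[of "d / 2"])
    fix f g assume fg: "f \<in> mspace path_space" "g \<in> mspace path_space"
      and "\<And>s. s \<in> {0..1} \<Longrightarrow> \<bar>f s - g s\<bar> \<le> d / 2"
    then have "mdist path_space f g \<le> d / 2"
      by (subst mdist_path_space_le) auto
    then show "\<bar>F f - F g\<bar> < \<epsilon>"
      using d(1) by (intro d(2) fg) linarith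
  qed (use d in auto)
qed

section \<open>Interpolated paths and Lipschitz functionals\<close>

text \<open>Arbitrary node values are allowed so that the same estimates serve particle trajectories
  and paths decoded from codes.\<close>

definition interp :: "nat \<Rightarrow> (nat \<Rightarrow> real) \<Rightarrow> real \<Rightarrow> real" where
  "interp m v =
     (\<lambda>s\<in>{0..1}. (1 - frac (s * real m)) * v (nat \<lfloor>s * real m\<rfloor>) +
                 frac (s * real m) * v (nat \<lfloor>s * real m\<rfloor> + 1))"

text \<open>Doubles as the left endpoint of spatial cell \<open>k\<close> at resolution
  \<open>n\<close>, so comparing a site with a cell amounts to comparing two fractions.\<close>

definition pos :: "nat \<Rightarrow> nat \<Rightarrow> real" where
  "pos n k = 2 * real k / real n - 1"

lemma trajectory_eq_interp: "trajectory n m \<sigma> i = interp m (\<lambda>t. pos n (\<sigma> t i))"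
  by (simp add: trajectory_def interp_def pos_def Let_def)

lemma pos_range: "n > 0 \<Longrightarrow> k \<le> n \<Longrightarrow> pos n k \<in> {-1..1}"
  by (auto simp: pos_def field_simps)

text \<open>The last grid interval degenerates at \<open>s = 1\<close>, where the weight of the second node is \<open>0\<close>.\<close>

lemma interp_nodes:
  assumes "m > 0" "s \<in> {0..1}"
  obtains a k l where "0 \<le> a" "a \<le> 1" "k \<le> m" "l \<le> m"
    "\<bar>s - real k / real m\<bar> \<le> 1 / real m" "\<bar>s - real l / real m\<bar> \<le> 1 / real m"
    "k = nat \<lfloor>s * real m\<rfloor>"
    "\<And>v. interp m v s = (1 - a) * v k + a * v l"
proof -
  define a where "a = frac (s * real m)"
  define k where "k = nat \<lfloor>s * real m\<rfloor>"
  have sm: "0 \<le> s * real m" "s * real m \<le> real m"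
    using assms by (auto simp: mult_left_le_one_le)
  have sk: "s * real m = real k + a"
    using sm by (simp add: a_def k_def frac_def)
  have a: "0 \<le> a" "a < 1"
    by (auto simp: a_def frac_lt_1)
  have k: "k \<le> m" using sk sm a by linarith
  have s: "s = real k / real m + a / real m"
    using sk assms by (simp add: field_simps)
  have eq: "interp m v s = (1 - a) * v k + a * v (k + 1)" for v
    using assms(2) by (simp only: interp_def restrict_apply' a_def k_def)
  have dist_k: "\<bar>s - real k / real m\<bar> \<le> 1 / real m"
    unfolding s using a by (simp add: divide_right_mono)
  show thesis
  proof (cases "k = m")
    case True
    then have "a = 0" using sk sm a by linarith
    show thesis
      by (rule that[of 0 k k, OF _ _ k k dist_k dist_k k_def]) (simp_all add: eq \<open>a = 0\<close>)
  next
    case False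
    have "s - real (k + 1) / real m = - ((1 - a) / real m)"
      unfolding s by (simp add: add_divide_distrib diff_divide_distrib)
    then have dist_l: "\<bar>s - real (k + 1) / real m\<bar> \<le> 1 / real m"
      using a by (simp add: divide_right_mono)
    show thesis
      by (rule that[of a k "k + 1", OF _ _ k _ dist_k dist_l k_def])
        (use a k False in \<open>simp_all add: eq\<close>)
  qed
qed

lemma convex_comb_abs_le:
  assumes "0 \<le> a" "a \<le> (1::real)" "\<bar>x\<bar> \<le> c" "\<bar>y\<bar> \<le> c"
  shows "\<bar>(1 - a) * x + a * y\<bar> \<le> c"
proof -
  have "\<bar>(1 - a) * x + a * y\<bar> \<le> \<bar>(1 - a) * x\<bar> + \<bar>a * y\<bar>" by simp
  also have "\<dots> \<le> (1 - a) * c + a * c"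
    using assms by (intro add_mono) (auto simp: abs_mult intro!: mult_left_mono)
  finally show ?thesis by (simp add: algebra_simps)
qed

lemma interp_dist_le:
  assumes "m > 0" "s \<in> {0..1}" "\<And>k. k \<le> m \<Longrightarrow> \<bar>v k - w k\<bar> \<le> c"
  shows "\<bar>interp m v s - interp m w s\<bar> \<le> c"
proof -
  obtain a k l where a: "0 \<le> a" "a \<le> 1" and kl: "k \<le> m" "l \<le> m"
    and eq: "\<And>v. interp m v s = (1 - a) * v k + a * v l"
    using interp_nodes[OF assms(1,2)] by metis
  have "interp m v s - interp m w s = (1 - a) * (v k - w k) + a * (v l - w l)"
    by (simp add: eq algebra_simps)
  then show ?thesis
    using convex_comb_abs_le[OF a assms(3)[OF kl(1)] assms(3)[OF kl(2)]] by simp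
qed

text \<open>The interpolant at \<open>s\<close> is a convex combination of values at nodes within
  \<open>1 / m\<close> of \<open>s\<close>, so only these have to be compared with
  \<open>y\<close>.\<close>

lemma interp_approx:
  assumes "m > 0" "s \<in> {0..1}"
    and "\<And>k. k \<le> m \<Longrightarrow> \<bar>s - real k / real m\<bar> \<le> 1 / real m \<Longrightarrow> \<bar>y - v k\<bar> \<le> c"
  shows "\<bar>y - interp m v s\<bar> \<le> c"
proof -
  obtain a k l where a: "0 \<le> a" "a \<le> 1" and kl: "k \<le> m" "l \<le> m"
      "\<bar>s - real k / real m\<bar> \<le> 1 / real m" "\<bar>s - real l / real m\<bar> \<le> 1 / real m"
    and eq: "\<And>v. interp m v s = (1 - a) * v k + a * v l"
    using interp_nodes[OF assms(1,2)] by metis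
  have "y - interp m v s = (1 - a) * (y - v k) + a * (y - v l)"
    by (simp add: eq algebra_simps)
  then show ?thesis
    using convex_comb_abs_le[OF a assms(3)[OF kl(1,3)] assms(3)[OF kl(2,4)]] by simp
qed

text \<open>The interval is closed on the right, as gluing requires: there the floor jumps to
  \<open>k + 1\<close>, yet both expressions equal \<open>v (k + 1)\<close>.\<close>

lemma interp_affine:
  assumes "m > 0" "k < m" "s \<in> {real k / real m .. real (k + 1) / real m}"
  shows "interp m v s = v k + (s * real m - real k) * (v (k + 1) - v k)"
proof -
  have s: "real k \<le> s * real m" "s * real m \<le> real k + 1"
    using assms by (auto simp: field_simps)
  have "0 \<le> s" using assms(3) by (auto intro: order_trans[rotated])
  moreover have "s \<le> 1"
  proof -
    have "s \<le> real (k + 1) / real m" using assms by simp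
    also have "\<dots> \<le> 1" using assms by (simp add: field_simps)
    finally show ?thesis .
  qed
  ultimately have s01: "s \<in> {0..1}" by simp
  show ?thesis
  proof (cases "s * real m = real k + 1")
    case True
    then have "\<lfloor>s * real m\<rfloor> = int k + 1" by (simp add: floor_eq_iff)
    then show ?thesis using s01 True
      by (simp add: interp_def frac_def nat_add_distrib)
  next
    case False
    then have "\<lfloor>s * real m\<rfloor> = int k" using s by (auto simp: floor_eq_iff)
    then show ?thesis using s01
      by (simp add: interp_def frac_def algebra_simps)
  qed
qed

lemma interp_in_path_space:
  assumes m: "m > 0" and v: "\<And>k. k \<le> m \<Longrightarrow> v k \<in> {-1..1}"
  shows "interp m v \<in> mspace path_space"
proof -
  let ?I = "\<lambda>k. {real k / real m .. real (k + 1) / real m}"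
  have "{0..1} \<subseteq> (\<Union>k\<in>{..<m}. ?I k)"
  proof
    fix s :: real assume s: "s \<in> {0..1}"
    then obtain a k l where k: "k \<le> m" "k = nat \<lfloor>s * real m\<rfloor>"
      using interp_nodes[OF m s] by metis
    have *: "real k \<le> s * real m" "s * real m \<le> real k + 1"
      using s m by (auto simp: k(2))
    show "s \<in> (\<Union>k\<in>{..<m}. ?I k)"
    proof (cases "k = m")
      \<comment> \<open>At \<open>s = 1\<close> the floor is \<open>m\<close>, one past the last
        interval, so the witness is \<open>m - 1\<close>.\<close>
      case True
      then have "s = 1" using * s m by (auto simp: field_simps)
      then show ?thesis using m
        by (intro UN_I[of "m - 1"]) (auto simp: field_simps of_nat_diff)
    next
      case False
      then show ?thesis using * k(1) m
        by (intro UN_I[of k]) (auto simp: field_simps)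
    qed
  qed
  moreover have "continuous_on (\<Union>k\<in>{..<m}. ?I k) (interp m v)"
  proof (rule continuous_on_closed_Union)
    fix k assume "k \<in> {..<m}"
    then have "continuous_on (?I k) (interp m v) \<longleftrightarrow>
        continuous_on (?I k) (\<lambda>s. v k + (s * real m - real k) * (v (k + 1) - v k))"
      using interp_affine[OF m] by (intro continuous_on_cong) auto
    then show "continuous_on (?I k) (interp m v)"
      by (auto intro!: continuous_intros)
  qed auto
  ultimately have "continuous_on {0..1} (interp m v)"
    by (rule continuous_on_subset[rotated])
  moreover have "interp m v s \<in> {-1..1}" if "s \<in> {0..1}" for s
  proof -
    \<comment> \<open>Comparison with the constant \<open>0\<close> bounds the modulus of the
      interpolant by that of its nodes.\<close>
    have "\<bar>0 - interp m v s\<bar> \<le> 1"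
      using v by (intro interp_approx[OF m that]) (force simp: abs_le_iff)
    then show ?thesis by (auto simp: abs_le_iff)
  qed
  moreover have "interp m v \<in> extensional {0..1}"
    by (simp add: interp_def)
  ultimately show ?thesis by (auto simp: mspace_path_space)
qed

lemma trajectory_in_path_space:
  assumes "permutation_process n m \<sigma>" "i \<in> {1..n}"
  shows "trajectory n m \<sigma> i \<in> mspace path_space"
  unfolding trajectory_eq_interp
proof (rule interp_in_path_space)
  fix k assume "k \<le> m"
  then have "\<sigma> k permutes {1..n}" using assms(1) by (simp add: permutation_process_def)
  then have "\<sigma> k i \<in> {1..n}" using assms(2) by (simp only: permutes_in_image)
  then show "pos n (\<sigma> k i) \<in> {-1..1}" using assms(2) by (intro pos_range) auto
qed (use assms in \<open>simp add: permutation_process_def\<close>)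

text \<open>Supplies the test functionals for the marginals of a limit: evaluation at
  \<open>t\<close> followed by a Lipschitz function, and the oscillation around
  \<open>t\<close>.\<close>

lemma uniformly_continuous_path_functionalI:
  fixes F :: "(real \<Rightarrow> real) \<Rightarrow> real"
  assumes "\<And>f h d. f \<in> mspace path_space \<Longrightarrow> h \<in> mspace path_space \<Longrightarrow>
      (\<And>s. s \<in> {0..1} \<Longrightarrow> \<bar>f s - h s\<bar> \<le> d) \<Longrightarrow> \<bar>F f - F h\<bar> \<le> K * d"
  shows "uniformly_continuous_map path_space euclidean_metric F"
  unfolding uniformly_continuous_map_def
proof (intro conjI allI impI)
  fix \<epsilon> :: real assume \<epsilon>: "\<epsilon> > 0"
  \<comment> \<open>The denominator \<open>\<bar>K\<bar> + 1\<close> is positive whatever the sign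
    of \<open>K\<close>.\<close>
  have K: "K * (\<epsilon> / (\<bar>K\<bar> + 1)) < \<epsilon>"
  proof -
    have "K * (\<epsilon> / (\<bar>K\<bar> + 1)) = \<epsilon> * (K / (\<bar>K\<bar> + 1))" by simp
    also have "\<dots> < \<epsilon> * 1" using \<epsilon> by (intro mult_strict_left_mono) (simp_all add: field_simps)
    finally show ?thesis by simp
  qed
  show "\<exists>\<delta>>0. \<forall>f\<in>mspace path_space. \<forall>h\<in>mspace path_space.
      mdist path_space h f < \<delta> \<longrightarrow> mdist euclidean_metric (F h) (F f) < \<epsilon>"
  proof (intro exI conjI ballI impI)
    show "\<epsilon> / (\<bar>K\<bar> + 1) > 0" using \<epsilon> by (simp add: add_nonneg_pos)
    fix f h assume fh: "f \<in> mspace path_space" "h \<in> mspace path_space"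
      and "mdist path_space h f < \<epsilon> / (\<bar>K\<bar> + 1)"
    then have "\<bar>h s - f s\<bar> \<le> \<epsilon> / (\<bar>K\<bar> + 1)" if "s \<in> {0..1}" for s
      using mdist_path_space_ge[OF fh(2,1) that] by linarith
    then have "\<bar>F h - F f\<bar> \<le> K * (\<epsilon> / (\<bar>K\<bar> + 1))" by (intro assms fh)
    then show "mdist euclidean_metric (F h) (F f) < \<epsilon>" using K by (simp add: dist_real_def)
  qed
qed auto

section \<open>Quantisation of a continuous process\<close>

definition bin :: "nat \<Rightarrow> real \<Rightarrow> nat" where
  "bin m y = nat \<lfloor>real m * (y + 1) / 2\<rfloor>"

lemma bin_le: "y \<in> {-1..1} \<Longrightarrow> bin m y \<le> m"
proof -
  assume y: "y \<in> {-1..1}"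
  have "real m * (y + 1) / 2 \<le> real m"
    using y mult_left_mono[of "y + 1" 2 "real m"] by simp
  then show ?thesis
    unfolding bin_def by linarith
qed

text \<open>A floor is below an integer exactly when the number itself is. Events about cells thus
  become half-line events, whose probabilities the marginals determine.\<close>

lemma bin_less_iff:
  assumes "m > 0" "y \<in> {-1..1}"
  shows "bin m y < b \<longleftrightarrow> y < pos m b"
proof -
  have "bin m y < b \<longleftrightarrow> real m * (y + 1) / 2 < real b"
    using assms unfolding bin_def by (subst nat_less_iff) (auto simp: floor_less_iff)
  also have "\<dots> \<longleftrightarrow> y < pos m b"
    using assms by (auto simp: pos_def field_simps)
  finally show ?thesis .
qed

lemma pos_bin:
  assumes "m > 0" "y \<in> {-1..1}"
  shows "\<bar>y - pos m (bin m y)\<bar> \<le> 2 / real m"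
proof -
  have "real m * (y + 1) / 2 \<ge> 0" using assms by (intro divide_nonneg_pos mult_nonneg_nonneg) auto
  then have "real (bin m y) \<le> real m * (y + 1) / 2" "real m * (y + 1) / 2 < real (bin m y) + 1"
    unfolding bin_def by linarith+
  then have "\<bar>real m * (y + 1) / 2 - real (bin m y)\<bar> \<le> 1" by linarith
  moreover have "y - pos m (bin m y) = (real m * (y + 1) / 2 - real (bin m y)) * (2 / real m)"
    using assms by (simp add: pos_def field_simps)
  ultimately show ?thesis
    using assms by (simp add: abs_mult mult_left_le_one_le divide_right_mono)
qed

lemma measurable_bin [measurable]: "bin m \<in> borel \<rightarrow>\<^sub>M count_space UNIV"
  unfolding bin_def by measurable

text \<open>
  The code of a path records the cells visited at the grid times; \<open>m\<close> is at once the resolution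
  in time and in space. The top cell \<open>m\<close> is hit only at the value \<open>1\<close>.
\<close>

definition codes :: "nat \<Rightarrow> (nat \<Rightarrow> nat) set" where
  "codes m = {..m} \<rightarrow>\<^sub>E {..m}"

lemma finite_codes [simp]: "finite (codes m)"
  by (simp add: codes_def finite_PiE)

lemma codes_le: "x \<in> codes m \<Longrightarrow> k \<le> m \<Longrightarrow> x k \<le> m"
  by (auto simp: codes_def)

definition code :: "nat \<Rightarrow> (real \<Rightarrow> 'a \<Rightarrow> real) \<Rightarrow> 'a \<Rightarrow> nat \<Rightarrow> nat" where
  "code m X \<omega> = (\<lambda>k\<in>{..m}. bin m (X (real k / real m) \<omega>))"

definition code_path :: "nat \<Rightarrow> (nat \<Rightarrow> nat) \<Rightarrow> real \<Rightarrow> real" where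
  "code_path m x = interp m (\<lambda>k. pos m (x k))"

lemma code_path_in_path_space:
  assumes "m > 0" "x \<in> codes m"
  shows "code_path m x \<in> mspace path_space"
  unfolding code_path_def
  using assms by (intro interp_in_path_space pos_range) (auto intro: codes_le)

section \<open>Laws of codes and discretised expectations\<close>

locale cont_process = prob_space M for M :: "'a measure" +
  fixes X :: "real \<Rightarrow> 'a \<Rightarrow> real"
  assumes measurable_X: "t \<in> {0..1} \<Longrightarrow> X t \<in> borel_measurable M"
    and path: "\<omega> \<in> space M \<Longrightarrow> sample_path X \<omega> \<in> mspace path_space"
begin

lemma X_range: "\<omega> \<in> space M \<Longrightarrow> t \<in> {0..1} \<Longrightarrow> X t \<omega> \<in> {-1..1}"
  using path_space_range[OF path, of \<omega> t] by (simp add: sample_path_def)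

lemma code_in_codes:
  assumes "m > 0" "\<omega> \<in> space M"
  shows "code m X \<omega> \<in> codes m"
  unfolding codes_def code_def using assms
  by (intro restrict_PiE_iff[THEN iffD2] ballI) (auto intro!: bin_le X_range)

text \<open>There are finitely many codes, each fixed by the cells at finitely many grid times, so
  measurability of the single marginals is enough for any \<open>P\<close>.\<close>

lemma code_event:
  assumes "m > 0"
  shows "{\<omega> \<in> space M. P (code m X \<omega>)} \<in> sets M"
proof -
  have 1: "{\<omega> \<in> space M. code m X \<omega> = x} \<in> sets M" if "x \<in> codes m" for x
  proof -
    have "{\<omega> \<in> space M. code m X \<omega> = x} =
        {\<omega> \<in> space M. \<forall>k\<in>{..m}. bin m (X (real k / real m) \<omega>) = x k}"
      using that by (auto simp: code_def codes_def fun_eq_iff PiE_def extensional_def restrict_def)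
    also have "\<dots> \<in> sets M"
    proof (rule sets.sets_Collect_finite_All')
      fix k assume k: "k \<in> {..m}"
      have [measurable]: "X (real k / real m) \<in> borel_measurable M"
        using k assms by (intro measurable_X) auto
      show "{\<omega> \<in> space M. bin m (X (real k / real m) \<omega>) = x k} \<in> sets M"
        by measurable
    qed auto
    finally show ?thesis .
  qed
  have "{\<omega> \<in> space M. P (code m X \<omega>)} =
      (\<Union>x\<in>{x \<in> codes m. P x}. {\<omega> \<in> space M. code m X \<omega> = x})"
    using code_in_codes[OF assms] by auto
  also have "\<dots> \<in> sets M"
    by (rule sets.finite_UN) (auto intro: 1)
  finally show ?thesis .
qed

definition weight :: "nat \<Rightarrow> (nat \<Rightarrow> nat) \<Rightarrow> real" where
  "weight m x = prob {\<omega> \<in> space M. code m X \<omega> = x}"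

text \<open>A function of the code is a simple function on the finite partition into code
  events.\<close>

lemma has_bochner_integral_code:
  assumes "m > 0"
  shows "has_bochner_integral M (\<lambda>\<omega>. h (code m X \<omega>)) (\<Sum>x\<in>codes m. weight m x * (h x :: real))"
proof -
  have "has_bochner_integral M
      (\<lambda>\<omega>. \<Sum>x\<in>codes m. indicat_real {\<omega> \<in> space M. code m X \<omega> = x} \<omega> * h x)
      (\<Sum>x\<in>codes m. weight m x * h x)"
    unfolding weight_def
    by (intro has_bochner_integral_sum has_bochner_integral_mult_left has_bochner_integral_real_indicator
        code_event assms) (simp add: less_top[symmetric])
  moreover have "(\<Sum>x\<in>codes m. indicat_real {\<omega> \<in> space M. code m X \<omega> = x} \<omega> * h x) =
      h (code m X \<omega>)" if "\<omega> \<in> space M" for \<omega>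
  proof -
    have "(\<Sum>x\<in>codes m. indicat_real {\<omega> \<in> space M. code m X \<omega> = x} \<omega> * h x) =
        (\<Sum>x\<in>codes m. if x = code m X \<omega> then h x else 0)"
      using that by (intro sum.cong) (auto simp: indicator_def)
    then show ?thesis using code_in_codes[OF assms that] by simp
  qed
  ultimately show ?thesis
    by (subst has_bochner_integral_cong[OF refl _ refl, symmetric]) auto
qed

text \<open>For a fixed path, uniform continuity controls the discretisation in time and the cell
  width that in space. \<open>Suc m\<close> excludes resolution \<open>0\<close>.\<close>

lemma code_path_tendsto:
  assumes F: "uniformly_continuous_map path_space euclidean_metric F" and \<omega>: "\<omega> \<in> space M"
  shows "(\<lambda>m. F (code_path (Suc m) (code (Suc m) X \<omega>))) \<longlonglongrightarrow> (F (sample_path X \<omega>) :: real)"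
proof (rule LIMSEQ_I)
  fix r :: real assume "r > 0"
  from uniformly_continuous_path_functional[OF F this]
  obtain d where d: "d > 0"
    "\<And>f g. f \<in> mspace path_space \<Longrightarrow> g \<in> mspace path_space \<Longrightarrow>
           (\<And>s. s \<in> {0..1} \<Longrightarrow> \<bar>f s - g s\<bar> \<le> d) \<Longrightarrow> \<bar>F f - F g\<bar> < r"
    by blast
  define f where "f = sample_path X \<omega>"
  have f: "f \<in> mspace path_space" unfolding f_def by (rule path[OF \<omega>])
  then have "uniformly_continuous_on {0..1} f"
    by (intro compact_uniformly_continuous) (auto simp: mspace_path_space)
  then obtain e where e: "e > 0"
    "\<And>s t. s \<in> {0..1} \<Longrightarrow> t \<in> {0..1} \<Longrightarrow> \<bar>s - t\<bar> < e \<Longrightarrow> \<bar>f s - f t\<bar> < d / 2"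
    using d(1) unfolding uniformly_continuous_on_def dist_real_def
    by (metis half_gt_zero)
  \<comment> \<open>The tolerance \<open>d\<close> is split in halves: a mesh below \<open>e\<close>
    costs \<open>d / 2\<close> in time, and a mesh below \<open>d / 4\<close> keeps the spatial
    error, twice the mesh, below \<open>d / 2\<close>.\<close>
  obtain N where N: "inverse (real (Suc N)) < min e (d / 4)"
    using reals_Archimedean[of "min e (d / 4)"] d e by auto
  show "\<exists>no. \<forall>m\<ge>no. norm (F (code_path (Suc m) (code (Suc m) X \<omega>)) - F (sample_path X \<omega>)) < r"
  proof (intro exI allI impI)
    fix m assume "m \<ge> N"
    define M' where "M' = Suc m"
    have M': "M' > 0" by (simp add: M'_def)
    have "1 / real M' \<le> inverse (real (Suc N))"
      using \<open>m \<ge> N\<close> by (simp add: M'_def field_simps)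
    with N have small: "1 / real M' < e" "1 / real M' < d / 4" by auto
    have "\<bar>f s - code_path M' (code M' X \<omega>) s\<bar> \<le> d" if s: "s \<in> {0..1}" for s
      unfolding code_path_def
    proof (rule interp_approx[OF M' s])
      fix k assume k: "k \<le> M'" "\<bar>s - real k / real M'\<bar> \<le> 1 / real M'"
      let ?t = "real k / real M'"
      have t: "?t \<in> {0..1}" using k M' by auto
      have "\<bar>f s - f ?t\<bar> < d / 2"
        using e(2)[OF s t] k small by linarith
      moreover have "\<bar>f ?t - pos M' (code M' X \<omega> k)\<bar> \<le> 2 / real M'"
        using pos_bin[OF M' X_range[OF \<omega> t]] k t by (simp add: code_def f_def sample_path_def)
      moreover have "2 / real M' \<le> d / 2" using small by linarith
      ultimately show "\<bar>f s - pos M' (code M' X \<omega> k)\<bar> \<le> d" by linarith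
    qed
    then have "\<bar>F f - F (code_path M' (code M' X \<omega>))\<bar> < r"
      by (intro d(2) f code_path_in_path_space code_in_codes M' \<omega>)
    then show "norm (F (code_path (Suc m) (code (Suc m) X \<omega>)) - F (sample_path X \<omega>)) < r"
      by (simp add: f_def M'_def abs_minus_commute)
  qed
qed

text \<open>No \<sigma>-algebra on \<open>path_space\<close> enters:
  \<open>F (sample_path X \<omega>)\<close> is measurable as a pointwise limit of functions of
  codes, and \<open>B\<close> provides the dominating constant.\<close>

lemma functional_convergence:
  assumes F: "uniformly_continuous_map path_space euclidean_metric F"
    and B: "\<And>f. f \<in> mspace path_space \<Longrightarrow> \<bar>F f\<bar> \<le> (B::real)"
  shows functional_integrable: "integrable M (\<lambda>\<omega>. F (sample_path X \<omega>))"
    and code_expectation_tendsto: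
      "(\<lambda>m. \<Sum>x\<in>codes m. weight m x * F (code_path m x)) \<longlonglongrightarrow> (\<integral>\<omega>. F (sample_path X \<omega>) \<partial>M)"
proof -
  let ?G = "\<lambda>m \<omega>. F (code_path (Suc m) (code (Suc m) X \<omega>))"
  have hb: "has_bochner_integral M (?G m) (\<Sum>x\<in>codes (Suc m). weight (Suc m) x * F (code_path (Suc m) x))" for m
    using has_bochner_integral_code[of "Suc m" "\<lambda>x. F (code_path (Suc m) x)"] by simp
  have meas [measurable]: "?G m \<in> borel_measurable M" for m
    using hb by (rule borel_measurable_has_bochner_integral)
  have [measurable]: "(\<lambda>\<omega>. F (sample_path X \<omega>)) \<in> borel_measurable M"
    by (rule borel_measurable_LIMSEQ_real[where u = ?G]) (auto intro: code_path_tendsto[OF F] meas)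
  have *: "AE \<omega> in M. (\<lambda>m. ?G m \<omega>) \<longlonglongrightarrow> F (sample_path X \<omega>)"
    "\<And>m. AE \<omega> in M. norm (?G m \<omega>) \<le> B"
    by (auto intro!: AE_I2 code_path_tendsto[OF F] B code_path_in_path_space code_in_codes)
  show "integrable M (\<lambda>\<omega>. F (sample_path X \<omega>))"
    by (rule integrable_dominated_convergence[where s = ?G and w = "\<lambda>_. B"]) (use * in auto)
  have "(\<lambda>m. integral\<^sup>L M (?G m)) \<longlonglongrightarrow> (\<integral>\<omega>. F (sample_path X \<omega>) \<partial>M)"
    by (rule integral_dominated_convergence[where w = "\<lambda>_. B"]) (use * in auto)
  then show "(\<lambda>m. \<Sum>x\<in>codes m. weight m x * F (code_path m x)) \<longlonglongrightarrow> (\<integral>\<omega>. F (sample_path X \<omega>) \<partial>M)"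
    by (subst filterlim_sequentially_Suc[symmetric])
      (simp add: has_bochner_integral_integral_eq[OF hb])
qed

end

section \<open>The marginals of a limit\<close>

text \<open>By the mean value theorem, the increment of an antiderivative over a cell of width
  \<open>2 / n\<close> is \<open>2 / n\<close> times a value of \<open>g\<close> inside it; the
  Lipschitz bound compares this with the value at the right endpoint.\<close>

lemma lipschitz_riemann_sum:
  fixes g :: "real \<Rightarrow> real"
  assumes lip: "\<And>x y. \<bar>g x - g y\<bar> \<le> L * \<bar>x - y\<bar>"
  shows "(\<lambda>n. 1 / real n * (\<Sum>i=1..n. g (pos n i)))
    \<longlonglongrightarrow> (\<integral>x. g x \<partial>uniform_measure lborel {-1..1})"
proof -
  have "L \<ge> 0" using lip[of 1 0] abs_ge_zero[of "g 1 - g 0"] by simp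
  then have "L-lipschitz_on UNIV g"
    using lip by (intro lipschitz_onI) (auto simp: dist_real_def)
  then have "continuous_on UNIV g" by (rule lipschitz_on_continuous_on)
  then have cont: "isCont g x" for x by (simp add: continuous_on_eq_continuous_at)
  then have [measurable]: "g \<in> borel_measurable borel"
    by (intro borel_measurable_continuous_onI) (simp add: continuous_at_imp_continuous_on)
  obtain G where "\<And>x. (G has_vector_derivative g x) (at x)"
    using einterval_antiderivative[of "-\<infinity>" "\<infinity>" g] cont by auto
  then have G: "(G has_real_derivative g x) (at x)" for x
    by (simp add: has_real_derivative_iff_has_vector_derivative)
  define I where "I = (\<integral>x. g x \<partial>uniform_measure lborel {-1..1})"
  \<comment> \<open>The interval has length \<open>2\<close>, so the density is
    \<open>1 / 2\<close>.\<close>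
  have "uniform_measure lborel {-1..1} = density lborel (\<lambda>x. ennreal (indicator {-1..1::real} x / 2))"
    unfolding uniform_measure_def
    by (rule density_cong) (auto simp: divide_ennreal[symmetric] split: split_indicator)
  then have "I = (\<integral>x. indicator {-1..1} x / 2 * g x \<partial>lborel)"
    by (simp add: I_def integral_density)
  also have "\<dots> = (\<integral>x. g x * indicator {-1..1} x \<partial>lborel) / 2"
    by (subst Bochner_Integration.integral_divide_zero[symmetric])
      (auto intro!: Bochner_Integration.integral_cong)
  also have "\<dots> = (G 1 - G (-1)) / 2"
    using integral_FTC_Icc_real[of "-1" 1 G g] G cont by simp
  finally have I: "I = (G 1 - G (-1)) / 2" .
  \<comment> \<open>Each of the \<open>n\<close> cells errs by at most \<open>4 * L / n^2\<close>;
    the total \<open>4 * L / n\<close> is halved because the sum of cells approximates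
    \<open>2 * I\<close>.\<close>
  have bound: "\<bar>1 / real n * (\<Sum>i=1..n. g (pos n i)) - I\<bar> \<le> 2 * L / real n" if "n > 0" for n
  proof -
    have step: "\<bar>2 / real n * g (pos n (Suc k)) - (G (pos n (Suc k)) - G (pos n k))\<bar> \<le> 2 / real n * (L * (2 / real n))"
      if "k < n" for k
    proof -
      have diff: "pos n (Suc k) - pos n k = 2 / real n"
        by (simp add: pos_def diff_divide_distrib[symmetric])
      then have "pos n k < pos n (Suc k)" using \<open>n > 0\<close> by (simp add: algebra_simps)
      then obtain z where z: "pos n k < z" "z < pos n (Suc k)"
        "G (pos n (Suc k)) - G (pos n k) = (pos n (Suc k) - pos n k) * g z"
        using MVT2[of "pos n k" "pos n (Suc k)" G g] G by auto
      have "\<bar>g (pos n (Suc k)) - g z\<bar> \<le> L * \<bar>pos n (Suc k) - z\<bar>" by (rule lip)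
      also have "\<dots> \<le> L * (2 / real n)"
        using z diff \<open>L \<ge> 0\<close> by (intro mult_left_mono) auto
      finally have "2 / real n * \<bar>g (pos n (Suc k)) - g z\<bar> \<le> 2 / real n * (L * (2 / real n))"
        by (intro mult_left_mono) auto
      moreover have "2 / real n * g (pos n (Suc k)) - (G (pos n (Suc k)) - G (pos n k)) =
          2 / real n * (g (pos n (Suc k)) - g z)"
        unfolding z(3) diff by (simp add: right_diff_distrib)
      ultimately show ?thesis by (simp only: abs_mult) simp
    qed
    \<comment> \<open>\<open>pos n 0 = -1\<close> and \<open>pos n n = 1\<close>, so the sum
      telescopes to the full increment of \<open>G\<close>.\<close>
    have "(\<Sum>k<n. G (pos n (Suc k)) - G (pos n k)) = 2 * I"
      using that by (subst sum_lessThan_telescope) (simp add: pos_def I)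
    then have "2 * (1 / real n * (\<Sum>i=1..n. g (pos n i)) - I) =
        (\<Sum>k<n. 2 / real n * g (pos n (Suc k)) - (G (pos n (Suc k)) - G (pos n k)))"
      by (simp add: sum_subtractf sum_distrib_left sum_divide_distrib sum.atLeast1_atMost_eq right_diff_distrib)
    also have "\<bar>\<dots>\<bar> \<le> (\<Sum>k<n. 2 / real n * (L * (2 / real n)))"
      by (rule order.trans[OF sum_abs sum_mono]) (use step in auto)
    also have "\<dots> = 4 * L / real n" using that by simp
    finally show ?thesis by (simp add: abs_mult)
  qed
  have "(\<lambda>n. 2 * L / real n) \<longlonglongrightarrow> 0"
    by (rule tendsto_divide_0[OF tendsto_const])
      (simp add: filterlim_at_top_imp_at_infinity filterlim_real_sequentially)
  then have "(\<lambda>n. 1 / real n * (\<Sum>i=1..n. g (pos n i)) - I) \<longlonglongrightarrow> 0"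
    by (rule Lim_null_comparison[rotated])
      (use bound in \<open>auto intro!: eventually_mono[OF eventually_gt_at_top[of 0]]\<close>)
  then show ?thesis unfolding I_def by (rule LIM_zero_cancel)
qed

text \<open>
  Only at grid times are the positions of the particles exactly equidistributed; the oscillation
  around \<open>t\<close> bounds what is lost by moving \<open>t\<close> to a grid time.
\<close>

definition osc :: "real \<Rightarrow> real \<Rightarrow> (real \<Rightarrow> real) \<Rightarrow> real" where
  "osc t \<delta> f = (SUP s\<in>{0..1} \<inter> cball t \<delta>. \<bar>f s - f t\<bar>)"

lemma osc_le:
  assumes "t \<in> {0..1}" "\<delta> \<ge> 0" "\<And>s. s \<in> {0..1} \<Longrightarrow> \<bar>s - t\<bar> \<le> \<delta> \<Longrightarrow> \<bar>f s - f t\<bar> \<le> c"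
  shows "osc t \<delta> f \<le> c"
  unfolding osc_def
proof (rule cSUP_least)
  show "{0..1} \<inter> cball t \<delta> \<noteq> {}" using assms(1,2) by auto
qed (use assms in \<open>auto simp: dist_real_def abs_minus_commute\<close>)

lemma path_space_diff_le_2:
  assumes "f \<in> mspace path_space" "s \<in> {0..1}" "t \<in> {0..1}"
  shows "\<bar>f s - f t\<bar> \<le> 2"
  using path_space_range[OF assms(1,2)] path_space_range[OF assms(1,3)] by auto

lemma osc_ge:
  assumes f: "f \<in> mspace path_space" and "t \<in> {0..1}" "s \<in> {0..1}" "\<bar>s - t\<bar> \<le> \<delta>"
  shows "\<bar>f s - f t\<bar> \<le> osc t \<delta> f"
  unfolding osc_def
proof (rule cSUP_upper)
  show "bdd_above ((\<lambda>s. \<bar>f s - f t\<bar>) ` ({0..1} \<inter> cball t \<delta>))"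
    using path_space_diff_le_2[OF f _ assms(2)] by (intro bdd_aboveI2[where M = 2]) auto
qed (use assms in \<open>auto simp: dist_real_def abs_minus_commute\<close>)

lemma osc_bound:
  assumes "f \<in> mspace path_space" "t \<in> {0..1}" "\<delta> \<ge> 0"
  shows "\<bar>osc t \<delta> f\<bar> \<le> 2"
  using osc_le[of t \<delta> f 2] osc_ge[OF assms(1,2,2), of \<delta>] assms path_space_diff_le_2 by fastforce

text \<open>Both values in \<open>f s - f t\<close> move by at most \<open>d\<close>, hence the
  constant \<open>2\<close>. This makes the oscillation admissible in the convergence
  hypothesis.\<close>

lemma osc_uniformly_continuous:
  assumes t: "t \<in> {0..1}" and "\<delta> \<ge> 0"
  shows "uniformly_continuous_map path_space euclidean_metric (osc t \<delta>)"
proof (rule uniformly_continuous_path_functionalI)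
  have *: "osc t \<delta> f \<le> osc t \<delta> h + 2 * d"
    if "f \<in> mspace path_space" "h \<in> mspace path_space"
      "\<And>s. s \<in> {0..1} \<Longrightarrow> \<bar>f s - h s\<bar> \<le> d" for f h d
  proof (rule osc_le[OF assms])
    fix s assume s: "s \<in> {0..1}" "\<bar>s - t\<bar> \<le> \<delta>"
    show "\<bar>f s - f t\<bar> \<le> osc t \<delta> h + 2 * d"
      using osc_ge[OF that(2) t s] that(3)[OF s(1)] that(3)[OF t] by linarith
  qed
  fix f h :: "real \<Rightarrow> real" and d
  assume fh: "f \<in> mspace path_space" "h \<in> mspace path_space"
    "\<And>s. s \<in> {0..1} \<Longrightarrow> \<bar>f s - h s\<bar> \<le> d"
  have "osc t \<delta> f \<le> osc t \<delta> h + 2 * d" by (rule *[OF fh])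
  moreover have "osc t \<delta> h \<le> osc t \<delta> f + 2 * d"
    by (rule *[OF fh(2,1)]) (use fh(3) in \<open>simp add: abs_minus_commute\<close>)
  ultimately show "\<bar>osc t \<delta> f - osc t \<delta> h\<bar> \<le> 2 * d" by linarith
qed

lemma osc_tendsto_0:
  assumes f: "f \<in> mspace path_space" and t: "t \<in> {0..1}"
  shows "(\<lambda>k. osc t (1 / real (Suc k)) f) \<longlonglongrightarrow> 0"
proof (rule LIMSEQ_I)
  fix r :: real assume r: "r > 0"
  have "continuous_on {0..1} f" using f by (simp add: mspace_path_space)
  then obtain d where d: "d > 0" "\<And>s. s \<in> {0..1} \<Longrightarrow> \<bar>s - t\<bar> < d \<Longrightarrow> \<bar>f s - f t\<bar> < r / 2"
    using t r unfolding continuous_on_iff dist_real_def by (metis half_gt_zero)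
  obtain N where N: "inverse (real (Suc N)) < d" using reals_Archimedean[OF d(1)] by auto
  show "\<exists>no. \<forall>k\<ge>no. norm (osc t (1 / real (Suc k)) f - 0) < r"
  proof (intro exI allI impI)
    fix k assume "k \<ge> N"
    then have "1 / real (Suc k) \<le> inverse (real (Suc N))" by (simp add: field_simps)
    then have "osc t (1 / real (Suc k)) f \<le> r / 2"
      using N d(2) by (intro osc_le[OF t]) (auto intro: less_imp_le)
    moreover have "0 \<le> osc t (1 / real (Suc k)) f"
      using osc_ge[OF f t t, of "1 / real (Suc k)"] by simp
    ultimately show "norm (osc t (1 / real (Suc k)) f - 0) < r" using r by simp
  qed
qed

section \<open>Identification of the limiting marginals\<close>

context cont_process
begin

text \<open>Two limits in a fixed order: with the window \<open>\<delta>\<close> fixed,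
  \<open>n\<close> tends to infinity and averages become expectations; only then does the window
  shrink.\<close>

lemma lipschitz_expectation_of_limit:
  fixes g :: "real \<Rightarrow> real"
  assumes perm: "\<And>n. n \<ge> 1 \<Longrightarrow> permutation_process n (len n) (\<sigma> n)"
    and len: "filterlim len at_top sequentially"
    and conv: "processes_converge_to len \<sigma> M X"
    and t: "t \<in> {0..1}"
    and lip: "\<And>x y. \<bar>g x - g y\<bar> \<le> L * \<bar>x - y\<bar>" and bound: "\<And>x. \<bar>g x\<bar> \<le> B"
  shows "(\<integral>\<omega>. g (X t \<omega>) \<partial>M) = (\<integral>x. g x \<partial>uniform_measure lborel {-1..1})"
proof -
  define U where "U = (\<integral>x. g x \<partial>uniform_measure lborel {-1..1})"
  have L: "L \<ge> 0" using lip[of 1 0] abs_ge_zero[of "g 1 - g 0"] by simp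
  have "uniformly_continuous_map path_space euclidean_metric (\<lambda>f. g (f t))"
  proof (rule uniformly_continuous_path_functionalI)
    fix f h :: "real \<Rightarrow> real" and d
    assume "\<And>s. s \<in> {0..1} \<Longrightarrow> \<bar>f s - h s\<bar> \<le> d"
    then have "L * \<bar>f t - h t\<bar> \<le> L * d" using t L by (intro mult_left_mono) auto
    then show "\<bar>g (f t) - g (h t)\<bar> \<le> L * d" using lip order.trans by blast
  qed
  moreover have "bounded ((\<lambda>f. g (f t)) ` mspace path_space)"
    by (rule boundedI[of _ B]) (use bound in auto)
  ultimately have "(\<lambda>n. 1 / real n * (\<Sum>i=1..n. g (trajectory n (len n) (\<sigma> n) i t)))
      \<longlonglongrightarrow> (\<integral>\<omega>. g (sample_path X \<omega> t) \<partial>M)"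
    using conv unfolding processes_converge_to_def by blast
  then have lim1: "(\<lambda>n. 1 / real n * (\<Sum>i=1..n. g (trajectory n (len n) (\<sigma> n) i t)))
      \<longlonglongrightarrow> (\<integral>\<omega>. g (X t \<omega>) \<partial>M)"
    using t by (simp add: sample_path_def)
  have lim2: "(\<lambda>n. 1 / real n * (\<Sum>i=1..n. g (pos n i))) \<longlonglongrightarrow> U"
    unfolding U_def by (rule lipschitz_riemann_sum[OF lip])
  have close: "\<bar>(\<integral>\<omega>. g (X t \<omega>) \<partial>M) - U\<bar> \<le> L * (\<integral>\<omega>. osc t \<delta> (sample_path X \<omega>) \<partial>M)"
    if \<delta>: "\<delta> > 0" for \<delta>
  proof -
    have "bounded (osc t \<delta> ` mspace path_space)"
      using osc_bound[OF _ t] \<delta> by (intro boundedI[of _ 2]) auto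
    then have lim3: "(\<lambda>n. 1 / real n * (\<Sum>i=1..n. osc t \<delta> (trajectory n (len n) (\<sigma> n) i)))
        \<longlonglongrightarrow> (\<integral>\<omega>. osc t \<delta> (sample_path X \<omega>) \<partial>M)"
      using conv osc_uniformly_continuous[OF t, of \<delta>] \<delta> unfolding processes_converge_to_def by simp
    show ?thesis
    proof (rule tendsto_le[OF _ tendsto_mult[OF tendsto_const lim3] tendsto_rabs[OF tendsto_diff[OF lim1 lim2]]])
      \<comment> \<open>Once \<open>len n\<close> reaches \<open>Z\<close> the mesh is at most
        \<open>\<delta>\<close>, so some grid time lies in the window around
        \<open>t\<close>.\<close>
      define Z where "Z = nat \<lceil>1 / \<delta>\<rceil>"
      have "\<forall>\<^sub>F n in sequentially. Z \<le> len n"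
        using len by (simp add: filterlim_at_top)
      with eventually_ge_at_top[of 1]
      show "\<forall>\<^sub>F n in sequentially.
          \<bar>1 / real n * (\<Sum>i=1..n. g (trajectory n (len n) (\<sigma> n) i t)) - 1 / real n * (\<Sum>i=1..n. g (pos n i))\<bar>
          \<le> L * (1 / real n * (\<Sum>i=1..n. osc t \<delta> (trajectory n (len n) (\<sigma> n) i)))"
      proof eventually_elim
        case (elim n)
        define m where "m = len n"
        define T where "T i = trajectory n m (\<sigma> n) i" for i
        have pp: "permutation_process n m (\<sigma> n)" using perm elim(1) by (simp add: m_def)
        then have m: "m > 0" by (simp add: permutation_process_def)
        have "1 / \<delta> \<le> real m" using elim(2) unfolding Z_def m_def by linarith
        then have m\<delta>: "1 / real m \<le> \<delta>" using m \<delta> by (simp add: field_simps)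
        obtain k where k: "k \<le> m" "\<bar>t - real k / real m\<bar> \<le> 1 / real m"
          using interp_nodes[OF m t] by metis
        have grid: "real k / real m \<in> {0..1}" using k(1) m by auto
        \<comment> \<open>The sum over sites is a reordering of the sum over particles at the grid
          time.\<close>
        have "\<sigma> n k permutes {1..n}" using pp k(1) by (simp add: permutation_process_def)
        from sum.permute[OF this, of "\<lambda>i. g (pos n i)"]
        have "(\<Sum>i=1..n. g (pos n i)) = (\<Sum>i=1..n. g (T i (real k / real m)))"
          by (simp add: T_def trajectory_grid[OF m k(1)] pos_def o_def)
        then have "(\<Sum>i=1..n. g (T i t)) - (\<Sum>i=1..n. g (pos n i)) =
            (\<Sum>i=1..n. g (T i t) - g (T i (real k / real m)))"
          by (simp add: sum_subtractf)
        also have "\<bar>\<dots>\<bar> \<le> (\<Sum>i=1..n. L * osc t \<delta> (T i))"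
        proof (rule order.trans[OF sum_abs sum_mono])
          fix i assume "i \<in> {1..n}"
          then have Ti: "T i \<in> mspace path_space"
            unfolding T_def by (rule trajectory_in_path_space[OF pp])
          have "\<bar>T i (real k / real m) - T i t\<bar> \<le> osc t \<delta> (T i)"
            using k(2) m\<delta> by (intro osc_ge[OF Ti t grid]) (simp add: abs_minus_commute)
          then have "L * \<bar>T i t - T i (real k / real m)\<bar> \<le> L * osc t \<delta> (T i)"
            using L by (intro mult_left_mono) (simp_all add: abs_minus_commute)
          then show "\<bar>g (T i t) - g (T i (real k / real m))\<bar> \<le> L * osc t \<delta> (T i)"
            using lip order.trans by blast
        qed
        finally have "1 / real n * \<bar>(\<Sum>i=1..n. g (T i t)) - (\<Sum>i=1..n. g (pos n i))\<bar>
            \<le> 1 / real n * (\<Sum>i=1..n. L * osc t \<delta> (T i))"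
          by (rule mult_left_mono) simp
        moreover have "1 / real n * \<bar>(\<Sum>i=1..n. g (T i t)) - (\<Sum>i=1..n. g (pos n i))\<bar> =
            \<bar>1 / real n * (\<Sum>i=1..n. g (T i t)) - 1 / real n * (\<Sum>i=1..n. g (pos n i))\<bar>"
          by (simp add: right_diff_distrib[symmetric] abs_mult del: times_divide_eq_left)
        ultimately show ?case
          unfolding T_def m_def by (simp add: sum_distrib_left[symmetric] mult.left_commute)
      qed
    qed simp
  qed
  have integrable: "integrable M (\<lambda>\<omega>. osc t (1 / real (Suc k)) (sample_path X \<omega>))" for k
    by (rule functional_integrable[OF osc_uniformly_continuous[OF t] osc_bound[OF _ t]]) auto
  have "(\<lambda>k. \<integral>\<omega>. osc t (1 / real (Suc k)) (sample_path X \<omega>) \<partial>M) \<longlonglongrightarrow> (\<integral>\<omega>. 0 \<partial>M)"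
  \<comment> \<open>Oscillations vanish along each continuous path and never exceed
    \<open>2\<close>.\<close>
  proof (rule integral_dominated_convergence[where w = "\<lambda>_. 2"])
    show "AE \<omega> in M. norm (osc t (1 / real (Suc k)) (sample_path X \<omega>)) \<le> 2" for k
      using osc_bound[OF path t] by (intro AE_I2) simp
  qed (use integrable osc_tendsto_0[OF path t] in \<open>auto intro: AE_I2\<close>)
  then have "(\<lambda>k. L * (\<integral>\<omega>. osc t (1 / real (Suc k)) (sample_path X \<omega>) \<partial>M)) \<longlonglongrightarrow> 0"
    by (auto intro: tendsto_mult_right_zero)
  then have "\<bar>(\<integral>\<omega>. g (X t \<omega>) \<partial>M) - U\<bar> \<le> 0"
    by (rule LIMSEQ_le_const) (use close in auto)
  then show ?thesis by (simp add: U_def)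
qed

text \<open>A law on the line is determined by its characteristic function, whose real and imaginary
  parts integrate functions bounded by \<open>1\<close> and Lipschitz with constant
  \<open>\<bar>\<theta>\<bar>\<close>.\<close>

lemma limit_marginal_uniform:
  assumes perm: "\<And>n. n \<ge> 1 \<Longrightarrow> permutation_process n (len n) (\<sigma> n)"
    and len: "filterlim len at_top sequentially"
    and conv: "processes_converge_to len \<sigma> M X"
    and t: "t \<in> {0..1}"
  shows "distr M borel (X t) = uniform_measure lborel {-1..1}"
proof (rule Levy_uniqueness)
  let ?D = "distr M borel (X t)" and ?U = "uniform_measure lborel {-1..1::real}"
  have X [measurable]: "X t \<in> borel_measurable M" by (rule measurable_X[OF t])
  show D: "real_distribution ?D" by simp
  interpret U: prob_space ?U by (rule prob_space_uniform_measure) auto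
  show U: "real_distribution ?U" by unfold_locales simp
  have lipschitz: "(\<integral>x. g x \<partial>?D) = (\<integral>x. g x \<partial>?U)"
    if "\<And>x y. \<bar>g x - g y\<bar> \<le> L * \<bar>x - y\<bar>" "\<And>x. \<bar>g x\<bar> \<le> B" and [measurable]: "g \<in> borel_measurable borel"
    for g :: "real \<Rightarrow> real" and L B
    using lipschitz_expectation_of_limit[OF perm len conv t that(1,2)]
    by (simp add: integral_distr)
  show "char ?D = char ?U"
  proof
    fix \<theta>
    have "Re (char N \<theta>) = (\<integral>x. cos (\<theta> * x) \<partial>N)" "Im (char N \<theta>) = (\<integral>x. sin (\<theta> * x) \<partial>N)"
      if "real_distribution N" for N
    proof -
      interpret N: real_distribution N by fact
      have cis: "char N \<theta> = (\<integral>x. cis (\<theta> * x) \<partial>N)"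
        unfolding char_def cis_conv_exp ..
      have int: "integrable N (\<lambda>x. cis (\<theta> * x))"
        unfolding cis_conv_exp by (rule N.integrable_iexp) simp_all
      show "Re (char N \<theta>) = (\<integral>x. cos (\<theta> * x) \<partial>N)"
        unfolding cis integral_Re[OF int, symmetric] by simp
      show "Im (char N \<theta>) = (\<integral>x. sin (\<theta> * x) \<partial>N)"
        unfolding cis integral_Im[OF int, symmetric] by simp
    qed
    moreover have "(\<integral>x. cos (\<theta> * x) \<partial>?D) = (\<integral>x. cos (\<theta> * x) \<partial>?U)"
    proof (rule lipschitz)
      fix x y :: real
      have "norm (cos (\<theta> * x) - cos (\<theta> * y)) \<le> \<bar>\<theta>\<bar> * norm (x - y)"
        by (rule field_differentiable_bound[where S = UNIV and f' = "\<lambda>x. - sin (\<theta> * x) * \<theta>"])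
          (auto intro!: derivative_eq_intros simp: abs_mult mult_left_le_one_le)
      then show "\<bar>cos (\<theta> * x) - cos (\<theta> * y)\<bar> \<le> \<bar>\<theta>\<bar> * \<bar>x - y\<bar>" by simp
    qed (auto intro: abs_cos_le_one)
    moreover have "(\<integral>x. sin (\<theta> * x) \<partial>?D) = (\<integral>x. sin (\<theta> * x) \<partial>?U)"
    proof (rule lipschitz)
      fix x y :: real
      have "norm (sin (\<theta> * x) - sin (\<theta> * y)) \<le> \<bar>\<theta>\<bar> * norm (x - y)"
        by (rule field_differentiable_bound[where S = UNIV and f' = "\<lambda>x. cos (\<theta> * x) * \<theta>"])
          (auto intro!: derivative_eq_intros simp: abs_mult mult_left_le_one_le)
      then show "\<bar>sin (\<theta> * x) - sin (\<theta> * y)\<bar> \<le> \<bar>\<theta>\<bar> * \<bar>x - y\<bar>" by simp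
    qed (auto intro: abs_sin_le_one)
    ultimately show "char ?D \<theta> = char ?U \<theta>" using D U by (simp add: complex_eq_iff)
  qed
qed

end

section \<open>Approximation of a permuton process\<close>

text \<open>Cumulative sums are rounded instead of single weights: each element receives the
  difference of two consecutive floors. Errors do not accumulate, and the total is the floor of the
  full sum.\<close>

lemma exists_rounding:
  fixes p :: "'c \<Rightarrow> real"
  assumes "finite C" "\<And>x. x \<in> C \<Longrightarrow> p x \<ge> 0"
  shows "\<exists>c. (\<forall>i\<in>{1..nat \<lfloor>real n * sum p C\<rfloor>}. c i \<in> C) \<and>
    (\<forall>x\<in>C. \<bar>real (card {i \<in> {1..nat \<lfloor>real n * sum p C\<rfloor>}. c i = x}) - real n * p x\<bar> \<le> 1)"
  using assms
proof (induction C rule: finite_induct)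
  case empty
  then show ?case by simp
next
  case (insert x C)
  define N where "N = nat \<lfloor>real n * sum p C\<rfloor>"
  define N' where "N' = nat \<lfloor>real n * sum p (insert x C)\<rfloor>"
  obtain c where c: "\<And>i. i \<in> {1..N} \<Longrightarrow> c i \<in> C"
    "\<And>y. y \<in> C \<Longrightarrow> \<bar>real (card {i \<in> {1..N}. c i = y}) - real n * p y\<bar> \<le> 1"
    using insert.IH[OF insert.prems] unfolding N_def by blast
  have split: "real n * sum p (insert x C) = real n * sum p C + real n * p x"
    using insert.hyps by (simp add: algebra_simps)
  have nonneg: "0 \<le> real n * sum p C" "0 \<le> real n * p x"
    using insert.prems by (auto intro!: mult_nonneg_nonneg sum_nonneg)
  have N: "real N \<le> real n * sum p C" "real n * sum p C < real N + 1"
    using nonneg unfolding N_def by linarith+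
  have N': "real N' \<le> real n * sum p C + real n * p x" "real n * sum p C + real n * p x < real N' + 1"
    using nonneg unfolding N'_def split by linarith+
  have le: "N \<le> N'" using N N' nonneg by linarith
  \<comment> \<open>Indices up to \<open>N\<close> keep their element; the new block from
    \<open>N + 1\<close> to \<open>N'\<close> goes to \<open>x\<close>.\<close>
  define c' where "c' i = (if i \<le> N then c i else x)" for i
  have 1: "{i \<in> {1..N'}. c' i = y} = {i \<in> {1..N}. c i = y}" if "y \<in> C" for y
    using that insert.hyps le by (auto simp: c'_def)
  have "{i \<in> {1..N'}. c' i = x} = {N + 1..N'}"
    using insert.hyps le c(1) by (force simp: c'_def)
  then have 2: "real (card {i \<in> {1..N'}. c' i = x}) = real N' - real N"
    using le by (simp add: of_nat_diff)
  have "\<bar>real (card {i \<in> {1..N'}. c' i = y}) - real n * p y\<bar> \<le> 1" if "y \<in> insert x C" for y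
  proof (cases "y = x")
    case True
    \<comment> \<open>The block length errs by a difference of two numbers in
      \<open>[0,1)\<close>.\<close>
    then show ?thesis using 2 N N' by simp
  next
    case False
    then show ?thesis using that 1 c(2) by simp
  qed
  moreover have "c' i \<in> insert x C" if "i \<in> {1..N'}" for i
    using that c(1) by (auto simp: c'_def)
  ultimately show ?case unfolding N'_def by blast
qed

text \<open>Ties between keys are broken by index, which makes the order total and the rank
  injective. Each index counts itself, hence the strict lower bound.\<close>

lemma exists_rank_permutation:
  fixes key :: "nat \<Rightarrow> 'b :: linorder"
  shows "\<exists>\<pi>. \<pi> permutes {1..n} \<and>
    (\<forall>i\<in>{1..n}. card {j \<in> {1..n}. key j < key i} < \<pi> i \<and> \<pi> i \<le> card {j \<in> {1..n}. key j \<le> key i})"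
proof -
  define below where "below i = {j \<in> {1..n}. key j < key i \<or> key j = key i \<and> j \<le> i}" for i
  define \<pi> where "\<pi> i = (if i \<in> {1..n} then card (below i) else i)" for i
  have fin: "finite (below i)" for i by (simp add: below_def)
  have lt: "card (below i) < card (below j)"
    if "i \<in> {1..n}" "j \<in> {1..n}" "key i < key j \<or> key i = key j \<and> i < j" for i j
  proof (rule psubset_card_mono[OF fin])
    have "j \<in> below j" "j \<notin> below i" using that by (auto simp: below_def)
    moreover have "below i \<subseteq> below j" using that by (auto simp: below_def)
    ultimately show "below i \<subset> below j" by blast
  qed
  have "inj_on \<pi> {1..n}"
  proof (rule inj_onI, rule ccontr)
    fix i j assume ij: "i \<in> {1..n}" "j \<in> {1..n}" "\<pi> i = \<pi> j" "i \<noteq> j"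
    then consider "key i < key j \<or> key i = key j \<and> i < j" | "key j < key i \<or> key j = key i \<and> j < i"
      by fastforce
    then show False using lt[of i j] lt[of j i] ij by cases (auto simp: \<pi>_def)
  qed
  moreover have "\<pi> ` {1..n} \<subseteq> {1..n}"
  proof
    fix y assume "y \<in> \<pi> ` {1..n}"
    then obtain i where i: "i \<in> {1..n}" "y = card (below i)" by (auto simp: \<pi>_def)
    have "i \<in> below i" using i by (simp add: below_def)
    then have "card (below i) > 0" using fin card_gt_0_iff by blast
    moreover have "card (below i) \<le> card {1..n}"
      by (rule card_mono) (auto simp: below_def)
    ultimately show "y \<in> {1..n}" using i by simp
  qed
  ultimately have "bij_betw \<pi> {1..n} {1..n}"
    by (simp add: bij_betw_def endo_inj_surj)
  then have "\<pi> permutes {1..n}"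
    by (rule bij_imp_permutes) (auto simp: \<pi>_def)
  moreover have "card {j \<in> {1..n}. key j < key i} < \<pi> i" if i: "i \<in> {1..n}" for i
  proof -
    have "{j \<in> {1..n}. key j < key i} \<subset> below i"
      using i by (auto simp: below_def)
    then show ?thesis using i psubset_card_mono[OF fin] by (simp add: \<pi>_def)
  qed
  moreover have "\<pi> i \<le> card {j \<in> {1..n}. key j \<le> key i}" if i: "i \<in> {1..n}" for i
    using i by (auto simp: \<pi>_def below_def intro!: card_mono)
  ultimately show ?thesis by blast
qed

text \<open>Take the largest \<open>m \<le> n\<close> with \<open>q m \<le> n\<close>. Every fixed
  \<open>Z\<close> qualifies once \<open>n\<close> reaches both \<open>Z\<close> and
  \<open>q Z\<close>, so these maxima tend to infinity.\<close>

lemma exists_slow_sequence: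
  fixes q :: "nat \<Rightarrow> nat"
  obtains len where "\<And>n. len n > 0" "filterlim len at_top sequentially"
    "eventually (\<lambda>n. q (len n) \<le> n) sequentially"
proof -
  define A where "A n = {m \<in> {1..n}. q m \<le> n}" for n
  \<comment> \<open>The default \<open>1\<close> keeps the set nonempty and the length positive; it
    satisfies the bound as soon as \<open>n \<ge> q 1\<close>.\<close>
  define len where "len n = Max (insert 1 (A n))" for n
  have fin: "finite (insert 1 (A n))" for n by (simp add: A_def)
  have mem: "len n \<in> insert 1 (A n)" for n
    unfolding len_def by (rule Max_in[OF fin]) simp
  show thesis
  proof (rule that[of len])
    show "len n > 0" for n using mem[of n] by (auto simp: A_def)
    show "filterlim len at_top sequentially"
      unfolding filterlim_at_top
    proof
      fix Z
      have *: "Z \<le> len n" if n: "n \<ge> max Z (q Z)" for n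
      proof (cases "Z = 0")
        case False
        then have "Z \<in> insert 1 (A n)" using n by (simp add: A_def)
        then show ?thesis unfolding len_def by (intro Max_ge fin)
      qed simp
      show "\<forall>\<^sub>F n in sequentially. Z \<le> len n"
        using eventually_ge_at_top[of "max Z (q Z)"] by eventually_elim (rule *)
    qed
    have "q (len n) \<le> n" if "n \<ge> q 1" for n
      using mem[of n] that by (auto simp: A_def)
    then show "\<forall>\<^sub>F n in sequentially. q (len n) \<le> n"
      by (auto simp: eventually_sequentially)
  qed
qed

lemma sum_by_value:
  fixes h :: "'c \<Rightarrow> real"
  assumes "finite C" "finite I" "\<And>i. i \<in> I \<Longrightarrow> c i \<in> C"
  shows "(\<Sum>i\<in>I. h (c i)) = (\<Sum>x\<in>C. real (card {i \<in> I. c i = x}) * h x)"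
proof -
  have "(\<Sum>i\<in>I. h (c i)) = (\<Sum>x\<in>C. \<Sum>i\<in>{i \<in> I. c i = x}. h (c i))"
    using assms by (intro sum.group[symmetric]) auto
  also have "\<dots> = (\<Sum>x\<in>C. real (card {i \<in> I. c i = x}) * h x)"
    by (intro sum.cong refl) simp
  finally show ?thesis .
qed

text \<open>Every \<open>x\<close> is miscounted by at most one, which shifts the sum by at most
  \<open>B\<close>. Applied to indicators for particle counts, and to path functionals for their
  averages.\<close>

lemma rounded_average_dist:
  fixes p h :: "'c \<Rightarrow> real"
  assumes "finite C" "n > 0" "\<And>i. i \<in> {1..n} \<Longrightarrow> c i \<in> C"
    and "\<And>x. x \<in> C \<Longrightarrow> \<bar>real (card {i \<in> {1..n}. c i = x}) - real n * p x\<bar> \<le> 1"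
    and "\<And>x. x \<in> C \<Longrightarrow> \<bar>h x\<bar> \<le> B"
  shows "\<bar>(\<Sum>i=1..n. h (c i)) - real n * (\<Sum>x\<in>C. p x * h x)\<bar> \<le> real (card C) * B"
proof -
  have "(\<Sum>i=1..n. h (c i)) - real n * (\<Sum>x\<in>C. p x * h x) =
      (\<Sum>x\<in>C. (real (card {i \<in> {1..n}. c i = x}) - real n * p x) * h x)"
    by (subst sum_by_value[OF assms(1) _ assms(3)])
      (auto simp: sum_distrib_left sum_subtractf[symmetric] algebra_simps)
  also have "\<bar>\<dots>\<bar> \<le> (\<Sum>x\<in>C. B)"
  proof (rule order.trans[OF sum_abs sum_mono])
    fix x assume x: "x \<in> C"
    show "\<bar>(real (card {i \<in> {1..n}. c i = x}) - real n * p x) * h x\<bar> \<le> B"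
      using mult_mono[OF assms(4)[OF x] assms(5)[OF x]] by (simp add: abs_mult)
  qed
  finally show ?thesis by simp
qed

section \<open>Permutation processes that follow a permuton process\<close>

locale permuton = cont_process +
  assumes uniform: "t \<in> {0..1} \<Longrightarrow> distr M borel (X t) = uniform_measure lborel {-1..1}"
begin

text \<open>The truncation at \<open>1\<close> admits the threshold \<open>pos m (m + 1)\<close>,
  which arises when particles up to and including cell \<open>m\<close> are counted.\<close>

lemma prob_less:
  assumes "t \<in> {0..1}" "y \<ge> -1"
  shows "prob {\<omega> \<in> space M. X t \<omega> < y} = (min y 1 + 1) / 2"
proof -
  have [measurable]: "X t \<in> borel_measurable M" by (rule measurable_X[OF assms(1)])
  have "prob {\<omega> \<in> space M. X t \<omega> < y} = measure (distr M borel (X t)) {..<y}"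
    by (subst measure_distr) (auto intro!: arg_cong[where f = prob])
  also have "\<dots> = measure lborel ({-1..1} \<inter> {..<y}) / 2"
    unfolding uniform[OF assms(1)] by (subst measure_uniform_measure) auto
  also have "{-1..1} \<inter> {..<y} = (if y \<le> 1 then {-1..<y} else {-1..1})" by auto
  also have "measure lborel \<dots> = min y 1 + 1" using assms(2) by auto
  finally show ?thesis .
qed

lemma weight_nonneg: "weight m x \<ge> 0"
  by (simp add: weight_def)

lemma sum_weight_mult_of_bool:
  assumes "m > 0"
  shows "(\<Sum>x\<in>codes m. weight m x * of_bool (P x)) = prob {\<omega> \<in> space M. P (code m X \<omega>)}"
proof -
  have "(\<Sum>x\<in>codes m. weight m x * of_bool (P x)) = (\<integral>\<omega>. of_bool (P (code m X \<omega>)) \<partial>M)"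
    using has_bochner_integral_code[OF assms, of "\<lambda>x. of_bool (P x)"]
    by (simp add: has_bochner_integral_integral_eq)
  also have "\<dots> = (\<integral>\<omega>. indicator {\<omega> \<in> space M. P (code m X \<omega>)} \<omega> \<partial>M)"
    by (intro Bochner_Integration.integral_cong) (auto simp: indicator_def)
  also have "\<dots> = prob {\<omega> \<in> space M. P (code m X \<omega>)}"
    by (simp add: Int_absorb2 code_event[OF assms])
  finally show ?thesis .
qed

lemma sum_weight: "m > 0 \<Longrightarrow> sum (weight m) (codes m) = 1"
  using sum_weight_mult_of_bool[of m "\<lambda>_. True"] by (simp add: prob_space)

text \<open>Uniformity of the marginals enters the counting here: for \<open>b \<le> m\<close> the
  cells below \<open>b\<close> fill the fraction \<open>b / m\<close> of
  \<open>[-1,1]\<close>.\<close>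

lemma prob_code_less:
  assumes "m > 0" "k \<le> m"
  shows "prob {\<omega> \<in> space M. code m X \<omega> k < b} = min (real b) (real m) / real m"
proof -
  have t: "real k / real m \<in> {0..1}" using assms by auto
  have "prob {\<omega> \<in> space M. code m X \<omega> k < b} = prob {\<omega> \<in> space M. X (real k / real m) \<omega> < pos m b}"
    using bin_less_iff[OF assms(1) X_range[OF _ t]] assms(2)
    by (intro arg_cong[where f = prob]) (auto simp: code_def)
  also have "\<dots> = (min (pos m b) 1 + 1) / 2"
    by (rule prob_less[OF t]) (simp add: pos_def)
  also have "\<dots> = min (real b) (real m) / real m"
    using assms by (auto simp: pos_def min_def field_simps)
  finally show ?thesis .
qed

text \<open>
  Ranking the particles at time \<open>0\<close> relabels them; \<open>\<pi>\<close> is this relabelling, needed because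
  \<open>\<sigma> 0 = id\<close>: particle \<open>\<pi> i\<close> follows the code \<open>c i\<close>.
\<close>

definition approximates ::
  "nat \<Rightarrow> nat \<Rightarrow> (nat \<Rightarrow> nat \<Rightarrow> nat) \<Rightarrow> (nat \<Rightarrow> nat) \<Rightarrow> (nat \<Rightarrow> nat \<Rightarrow> nat) \<Rightarrow> bool" where
  "approximates n m \<sigma> \<pi> c \<longleftrightarrow>
    permutation_process n m \<sigma> \<and> \<pi> permutes {1..n} \<and>
    (\<forall>i\<in>{1..n}. c i \<in> codes m) \<and>
    (\<forall>x\<in>codes m. \<bar>real (card {i \<in> {1..n}. c i = x}) - real n * weight m x\<bar> \<le> 1) \<and>
    (\<forall>i\<in>{1..n}. \<forall>k\<le>m. \<bar>pos n (\<sigma> k (\<pi> i)) - pos m (c i k)\<bar>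
        \<le> 2 / real m + 2 * real (card (codes m)) / real n)"

text \<open>A rank lies between the number of particles in strictly lower cells and the number in
  cells up to its own. Rounding puts these within \<open>card (codes m)\<close> of their expected
  values, which pins the rank near \<open>n * b / m\<close> for a particle in cell
  \<open>b\<close>.\<close>

lemma exists_approximating_process:
  assumes m: "m > 0" and n: "n > 0"
  shows "\<exists>\<sigma> \<pi> c. approximates n m \<sigma> \<pi> c"
proof -
  let ?R = "real (card (codes m))"
  \<comment> \<open>The weights sum to \<open>1\<close>, so the floor in the rounding lemma is
    exactly \<open>n\<close> and every particle gets a code.\<close>
  obtain c where c: "\<And>i. i \<in> {1..n} \<Longrightarrow> c i \<in> codes m"
    "\<And>x. x \<in> codes m \<Longrightarrow> \<bar>real (card {i \<in> {1..n}. c i = x}) - real n * weight m x\<bar> \<le> 1"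
    using exists_rounding[where C = "codes m" and p = "weight m" and n = n, OF finite_codes weight_nonneg]
    unfolding sum_weight[OF m] mult_1_right floor_of_nat nat_int by blast
  have count: "\<bar>real (card {i \<in> {1..n}. c i k < b}) - real n * (min (real b) (real m) / real m)\<bar> \<le> ?R"
    if "k \<le> m" for k b
  proof -
    have "(\<Sum>i=1..n. of_bool (c i k < b)) = real (card {i \<in> {1..n}. c i k < b})"
      by (simp add: of_bool_def sum.If_cases Int_def conj_commute)
    then show ?thesis
      using rounded_average_dist[of "codes m" n c "weight m" "\<lambda>x. of_bool (x k < b)" 1] n c
      by (simp add: sum_weight_mult_of_bool[OF m] prob_code_less[OF m that])
  qed
  have "\<forall>k. \<exists>\<rho>. \<rho> permutes {1..n} \<and> (\<forall>i\<in>{1..n}. card {j \<in> {1..n}. c j k < c i k} < \<rho> i \<and>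
      \<rho> i \<le> card {j \<in> {1..n}. c j k \<le> c i k})"
    by (intro allI exists_rank_permutation)
  from choice[OF this] obtain \<pi> where \<pi>: "\<And>k. \<pi> k permutes {1..n}"
    "\<And>k i. i \<in> {1..n} \<Longrightarrow> card {j \<in> {1..n}. c j k < c i k} < \<pi> k i"
    "\<And>k i. i \<in> {1..n} \<Longrightarrow> \<pi> k i \<le> card {j \<in> {1..n}. c j k \<le> c i k}"
    by blast
  define \<sigma> where "\<sigma> k = \<pi> k \<circ> inv (\<pi> 0)" for k
  have "permutation_process n m \<sigma>"
    unfolding permutation_process_def \<sigma>_def
    using m \<pi>(1) permutes_inv_o(1)[OF \<pi>(1)] permutes_compose[OF permutes_inv[OF \<pi>(1)] \<pi>(1)] by blast
  moreover have "\<bar>pos n (\<sigma> k (\<pi> 0 i)) - pos m (c i k)\<bar> \<le> 2 / real m + 2 * ?R / real n"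
    if i: "i \<in> {1..n}" and k: "k \<le> m" for i k
  proof -
    let ?b = "c i k"
    have \<sigma>: "\<sigma> k (\<pi> 0 i) = \<pi> k i"
      by (simp add: \<sigma>_def permutes_inverses(2)[OF \<pi>(1)])
    have b: "?b \<le> m" using codes_le c(1)[OF i] k by blast
    have "real n * (real ?b / real m) - ?R \<le> real (\<pi> k i)"
      using count[OF k, of ?b] \<pi>(2)[OF i, of k] b by (simp add: min_def split: if_splits)
    then have "(real n * (real ?b / real m) - ?R) / real n \<le> real (\<pi> k i) / real n"
      by (rule divide_right_mono) simp
    then have lower: "real ?b / real m - ?R / real n \<le> real (\<pi> k i) / real n"
      using n by (simp add: diff_divide_distrib)
    \<comment> \<open>Cells up to \<open>?b\<close> are those below \<open>Suc ?b\<close>; including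
      the own cell costs the extra \<open>1 / m\<close>.\<close>
    have "real (\<pi> k i) \<le> real (card {j \<in> {1..n}. c j k < Suc ?b})"
      using \<pi>(3)[OF i, of k] by (simp add: less_Suc_eq_le)
    also have "\<dots> \<le> real n * (min (real (Suc ?b)) (real m) / real m) + ?R"
      using count[OF k, of "Suc ?b"] by linarith
    also have "\<dots> \<le> real n * (real (Suc ?b) / real m) + ?R"
      by (intro add_right_mono mult_left_mono divide_right_mono) auto
    finally have "real (\<pi> k i) / real n \<le> (real n * (real (Suc ?b) / real m) + ?R) / real n"
      by (rule divide_right_mono) simp
    also have "\<dots> = real ?b / real m + 1 / real m + ?R / real n"
      using n by (simp add: add_divide_distrib)
    finally have upper: "real (\<pi> k i) / real n \<le> real ?b / real m + 1 / real m + ?R / real n" .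
    have "0 \<le> 1 / real m" "0 \<le> ?R / real n" by simp_all
    then have "\<bar>real (\<pi> k i) / real n - real ?b / real m\<bar> \<le> 1 / real m + ?R / real n"
      using lower upper by linarith
    moreover have "pos n (\<pi> k i) - pos m ?b = 2 * (real (\<pi> k i) / real n - real ?b / real m)"
      by (simp add: pos_def)
    ultimately show ?thesis unfolding \<sigma> by (simp add: abs_mult)
  qed
  ultimately have "approximates n m \<sigma> (\<pi> 0) c"
    unfolding approximates_def using c \<pi>(1)[of 0] by blast
  then show ?thesis by blast
qed

lemma exists_converging_processes:
  "\<exists>len \<sigma>. (\<forall>n\<ge>1. permutation_process n (len n) (\<sigma> n)) \<and>
     filterlim len at_top sequentially \<and> processes_converge_to len \<sigma> M X"
proof -
  \<comment> \<open>The choice of \<open>q\<close> forces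
    \<open>card (codes m) / n \<le> 1 / m\<close> for \<open>m = len n\<close>, so the position
    error in \<open>approximates\<close> is at most \<open>4 / m\<close>.\<close>
  obtain len where len: "\<And>n. len n > 0" "filterlim len at_top sequentially"
    "\<forall>\<^sub>F n in sequentially. len n * card (codes (len n)) \<le> n"
    using exists_slow_sequence[of "\<lambda>m. m * card (codes m)"] by blast
  have "\<exists>\<sigma> \<pi> c. approximates n (len n) \<sigma> \<pi> c" if "n \<ge> 1" for n
    using exists_approximating_process[OF len(1)] that by simp
  then obtain \<sigma> \<pi> c where approx: "\<And>n. n \<ge> 1 \<Longrightarrow> approximates n (len n) (\<sigma> n) (\<pi> n) (c n)"
    by metis
  have
    perm: "\<And>n. n \<ge> 1 \<Longrightarrow> permutation_process n (len n) (\<sigma> n)" and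
    \<pi>: "\<And>n. n \<ge> 1 \<Longrightarrow> \<pi> n permutes {1..n}" and
    c: "\<And>n i. n \<ge> 1 \<Longrightarrow> i \<in> {1..n} \<Longrightarrow> c n i \<in> codes (len n)" and
    count: "\<And>n x. n \<ge> 1 \<Longrightarrow> x \<in> codes (len n) \<Longrightarrow>
      \<bar>real (card {i \<in> {1..n}. c n i = x}) - real n * weight (len n) x\<bar> \<le> 1" and
    close: "\<And>n i k. n \<ge> 1 \<Longrightarrow> i \<in> {1..n} \<Longrightarrow> k \<le> len n \<Longrightarrow>
      \<bar>pos n (\<sigma> n k (\<pi> n i)) - pos (len n) (c n i k)\<bar>
        \<le> 2 / real (len n) + 2 * real (card (codes (len n))) / real n"
    using approx unfolding approximates_def by blast+
  have "processes_converge_to len \<sigma> M X"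
    unfolding processes_converge_to_def
  proof (intro allI impI, elim conjE)
    fix F :: "(real \<Rightarrow> real) \<Rightarrow> real"
    assume F: "uniformly_continuous_map path_space euclidean_metric F"
      and "bounded (F ` mspace path_space)"
    then obtain B where B: "B > 0" "\<And>f. f \<in> mspace path_space \<Longrightarrow> \<bar>F f\<bar> \<le> B"
      unfolding bounded_pos by auto
    \<comment> \<open>\<open>E\<close> averages \<open>F\<close> over the exact law of the codes and
      already has the desired limit; it remains to compare \<open>A n\<close> with
      \<open>E (len n)\<close>.\<close>
    define E where "E m = (\<Sum>x\<in>codes m. weight m x * F (code_path m x))" for m
    define A where "A n = 1 / real n * (\<Sum>i=1..n. F (trajectory n (len n) (\<sigma> n) i))" for n
    have "E \<longlonglongrightarrow> (\<integral>\<omega>. F (sample_path X \<omega>) \<partial>M)"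
      unfolding E_def by (rule code_expectation_tendsto[OF F B(2)])
    then have lim: "(\<lambda>n. E (len n)) \<longlonglongrightarrow> (\<integral>\<omega>. F (sample_path X \<omega>) \<partial>M)"
      by (rule filterlim_compose[OF _ len(2)])
    have "(\<lambda>n. A n - E (len n)) \<longlonglongrightarrow> 0"
    proof (rule tendstoI)
      fix r :: real assume r: "r > 0"
      obtain d where d: "d > 0"
        "\<And>f g. f \<in> mspace path_space \<Longrightarrow> g \<in> mspace path_space \<Longrightarrow>
           (\<And>s. s \<in> {0..1} \<Longrightarrow> \<bar>f s - g s\<bar> \<le> d) \<Longrightarrow> \<bar>F f - F g\<bar> < r / 2"
        using uniformly_continuous_path_functional[OF F, of "r / 2"] r by auto
      \<comment> \<open>The two terms give \<open>4 / m \<le> d\<close> for the paths and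
        \<open>B / m \<le> r / 4\<close> for the rounding; the total error is below
        \<open>r / 2 + r / 4\<close>, up to equality.\<close>
      define Z where "Z = nat \<lceil>max (4 / d) (4 * B / r)\<rceil>"
      have "\<forall>\<^sub>F n in sequentially. Z \<le> len n"
        using len(2) by (simp add: filterlim_at_top)
      with len(3) eventually_ge_at_top[of 1]
      show "\<forall>\<^sub>F n in sequentially. dist (A n - E (len n)) 0 < r"
      proof eventually_elim
        case (elim n)
        define m where "m = len n"
        have m: "m > 0" using len(1) by (simp add: m_def)
        have n: "n \<ge> 1" "real n > 0" using elim by auto
        have "max (4 / d) (4 * B / r) \<le> real m"
          using elim(3) unfolding Z_def m_def by linarith
        then have small: "4 / real m \<le> d" "B / real m \<le> r / 4"
          using m d(1) r by (auto simp: field_simps)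
        have "real m * real (card (codes m)) \<le> real n"
          using elim(1) unfolding m_def by (metis of_nat_le_iff of_nat_mult)
        then have R: "real (card (codes m)) / real n \<le> 1 / real m"
          using m n by (simp add: field_simps)
        have 1: "\<bar>(\<Sum>i=1..n. F (code_path m (c n i))) - real n * E m\<bar> \<le> real (card (codes m)) * B"
          unfolding E_def using c[OF n(1)] count[OF n(1)] n B(2) code_path_in_path_space[OF m]
          by (intro rounded_average_dist) (auto simp: m_def)
        have 2: "\<bar>(\<Sum>i=1..n. F (trajectory n m (\<sigma> n) (\<pi> n i))) - (\<Sum>i=1..n. F (code_path m (c n i)))\<bar>
            \<le> (\<Sum>i=1..n. r / 2)"
          unfolding sum_subtractf[symmetric]
        proof (rule order.trans[OF sum_abs sum_mono])
          fix i assume i: "i \<in> {1..n}"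
          have \<pi>i: "\<pi> n i \<in> {1..n}" using i by (simp only: permutes_in_image[OF \<pi>[OF n(1)]])
          have "\<bar>F (trajectory n m (\<sigma> n) (\<pi> n i)) - F (code_path m (c n i))\<bar> < r / 2"
          proof (rule d(2))
            show "trajectory n m (\<sigma> n) (\<pi> n i) \<in> mspace path_space"
              using perm[OF n(1)] \<pi>i by (intro trajectory_in_path_space) (simp_all add: m_def)
            show "code_path m (c n i) \<in> mspace path_space"
              using c[OF n(1) i] by (intro code_path_in_path_space[OF m]) (simp add: m_def)
            fix s :: real assume s: "s \<in> {0..1}"
            show "\<bar>trajectory n m (\<sigma> n) (\<pi> n i) s - code_path m (c n i) s\<bar> \<le> d"
              unfolding trajectory_eq_interp code_path_def
            proof (rule interp_dist_le[OF m s])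
              fix k assume "k \<le> m"
              then show "\<bar>pos n (\<sigma> n k (\<pi> n i)) - pos m (c n i k)\<bar> \<le> d"
                using close[OF n(1) i, of k] R small(1) unfolding m_def by linarith
            qed
          qed
          then show "\<bar>F (trajectory n m (\<sigma> n) (\<pi> n i)) - F (code_path m (c n i))\<bar> \<le> r / 2"
            by simp
        qed
        \<comment> \<open>Relabelling by \<open>\<pi> n\<close> only reorders the particles.\<close>
        have 3: "(\<Sum>i=1..n. F (trajectory n m (\<sigma> n) (\<pi> n i))) =
            (\<Sum>i=1..n. F (trajectory n m (\<sigma> n) i))"
          using sum.permute[OF \<pi>[OF n(1)], of "\<lambda>i. F (trajectory n m (\<sigma> n) i)"] by (simp add: o_def)
        have 4: "real (card (codes m)) * B \<le> real n * (r / 4)"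
        proof -
          have "real (card (codes m)) / real n * B \<le> 1 / real m * B"
            using R B(1) by (intro mult_right_mono) auto
          also have "\<dots> \<le> r / 4" using small(2) by simp
          finally show ?thesis using n by (simp add: field_simps)
        qed
        have "real n * (r / 2) + real n * (r / 4) < real n * r"
          using n r by simp
        moreover have "(\<Sum>i=1..n. r / 2) = real n * (r / 2)" by simp
        ultimately have "\<bar>(\<Sum>i=1..n. F (trajectory n m (\<sigma> n) i)) - real n * E m\<bar> < real n * r"
          using 1 2 4 unfolding 3 by linarith
        moreover have "(\<Sum>i=1..n. F (trajectory n m (\<sigma> n) i)) - real n * E m = real n * (A n - E m)"
          using n by (simp add: A_def m_def algebra_simps)
        ultimately show ?case
          using n by (simp add: abs_mult m_def)
      qed
    qed
    from tendsto_add[OF this lim]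
    show "(\<lambda>n. 1 / real n * (\<Sum>i = 1..n. F (trajectory n (len n) (\<sigma> n) i)))
        \<longlonglongrightarrow> (\<integral>\<omega>. F (sample_path X \<omega>) \<partial>M)"
      by (simp add: A_def)
  qed
  with perm len(2) show ?thesis by blast
qed

end

theorem theorem1:
  fixes M :: "'a measure" and X :: "real \<Rightarrow> 'a \<Rightarrow> real"
  shows
    "(\<forall>(len :: nat \<Rightarrow> nat) (\<sigma> :: nat \<Rightarrow> nat \<Rightarrow> nat \<Rightarrow> nat).
        (\<forall>n\<ge>1. permutation_process n (len n) (\<sigma> n)) \<and>
        filterlim len at_top sequentially \<and>
        continuous_process M X \<and>
        processes_converge_to len \<sigma> M X
        \<longrightarrow> permuton_process M X)
     \<and>
     (permuton_process M X \<longrightarrow>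
        (\<exists>(len :: nat \<Rightarrow> nat) (\<sigma> :: nat \<Rightarrow> nat \<Rightarrow> nat \<Rightarrow> nat).
           (\<forall>n\<ge>1. permutation_process n (len n) (\<sigma> n)) \<and>
           filterlim len at_top sequentially \<and>
           processes_converge_to len \<sigma> M X))"
proof (intro conjI allI impI, elim conjE)
  fix len :: "nat \<Rightarrow> nat" and \<sigma> :: "nat \<Rightarrow> nat \<Rightarrow> nat \<Rightarrow> nat"
  assume perm: "\<forall>n\<ge>1. permutation_process n (len n) (\<sigma> n)"
    and len: "filterlim len at_top sequentially"
    and X: "continuous_process M X"
    and conv: "processes_converge_to len \<sigma> M X"
  interpret cont_process M X
    using X by (simp add: continuous_process_def cont_process_def cont_process_axioms_def)
  \<comment> \<open>Path continuity is assumed, so only the marginals have to be identified.\<close>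
  show "permuton_process M X"
    using X limit_marginal_uniform[OF _ len conv] perm by (simp add: permuton_process_def)
next
  assume "permuton_process M X"
  then interpret permuton M X
    by (simp add: permuton_process_def continuous_process_def permuton_def permuton_axioms_def
        cont_process_def cont_process_axioms_def)
  show "\<exists>len \<sigma>. (\<forall>n\<ge>1. permutation_process n (len n) (\<sigma> n)) \<and>
      filterlim len at_top sequentially \<and> processes_converge_to len \<sigma> M X"
    by (rule exists_converging_processes)
qed

end
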